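(* Let $r=(0,x,x,x)^T$ with $x$ a nonnegative integer. For $n=4m+i$ with $m\ge 0$ and $0\le i\le 3$, let $R_n=R_i(S_4S_3S_2S_1)^m$, where $R_0=I$, $R_1=S_1$, $R_2=S_2S_1$, $R_3=S_3S_2S_1$. Then for every reduced word $w$ of length $n$ in the generators $S_1,\dots,S_4$, $$\|wr\|_\infty\le \|R_nr\|_\infty = O\!\left(\gamma^{n/4}\right),\qquad \gamma=\frac14\left(7+\sqrt{13}+2\sqrt{\tfrac{75}{2}+\tfrac{21\sqrt{13}}{2}}\right)\approx 8.795,$$ where $\gamma$ is the largest root of $t^4-7t^3-15t^2-7t+1$, the characteristic polynomial of $S_4S_3S_2S_1$.
   Context: The triangle group $T\subset GL(4,\mathbb{Z})$ is generated by $S_1=\begin{pmatrix}-1&1&1&1\\0&1&0&0\\0&0&1&0\\0&0&0&1\end{pmatrix}$, $S_2=\begin{pmatrix}1&0&0&0\\1&-1&1&1\\0&0&1&0\\0&0&0&1\end{pmatrix}$, $S_3=\begin{pmatrix}1&0&0&0\\0&1&0&0\\1&1&-1&1\\0&0&0&1\end{pmatrix}$, $S_4=\begin{pmatrix}1&0&0&0\\0&1&0&0\\0&0&1&0\\1&1&1&-1\end{pmatrix}$, acting on column vectors. A word in $S_1,\dots,S_4$ is reduced if it is not equal in $T$ to a word of smaller length. For a column vector $v=(a,b,c,d)^T$ with nonnegative entries, $\|v\|_\infty=\max(a,b,c,d)$.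
   Formalization: The printed closed form of γ (about 6.992) is not a root of the quartic and contradicts 8.795; it is corrected to γ = (7 + 3√13 + 2√(75/2 + 21√13/2))/4 ≈ 8.795, the largest root of the stated polynomial. *)

theory Defs
  imports
    "HOL-Library.Landau_Symbols"
    "Jordan_Normal_Form.Char_Poly"
begin

definition S1 :: "int mat" where
  "S1 = mat_of_rows_list 4
    [[-1, 1, 1, 1],
     [ 0, 1, 0, 0],
     [ 0, 0, 1, 0],
     [ 0, 0, 0, 1]]"

definition S2 :: "int mat" where
  "S2 = mat_of_rows_list 4
    [[ 1, 0, 0, 0],
     [ 1,-1, 1, 1],
     [ 0, 0, 1, 0],
     [ 0, 0, 0, 1]]"

definition S3 :: "int mat" where
  "S3 = mat_of_rows_list 4
    [[ 1, 0, 0, 0],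
     [ 0, 1, 0, 0],
     [ 1, 1,-1, 1],
     [ 0, 0, 0, 1]]"

definition S4 :: "int mat" where
  "S4 = mat_of_rows_list 4
    [[ 1, 0, 0, 0],
     [ 0, 1, 0, 0],
     [ 0, 0, 1, 0],
     [ 1, 1, 1,-1]]"

definition generators :: "int mat set" where
  "generators = {S1, S2, S3, S4}"

definition word_prod :: "int mat list \<Rightarrow> int mat" where
  "word_prod w = foldr (*) w (1\<^sub>m 4)"

text \<open>
  Words use the generators only, without formal inverses; each generator is an involution.
  The triangle group is a group of matrices, so equality in it is equality of matrix products.
\<close>

definition reduced_word :: "int mat list \<Rightarrow> bool" where
  "reduced_word w \<longleftrightarrow> w \<in> lists generators \<and>
     \<not> (\<exists>u \<in> lists generators. length u < length w \<and> word_prod u = word_prod w)"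

text \<open>On vectors with nonnegative entries this is the maximum of the entries.\<close>

definition sup_norm :: "int vec \<Rightarrow> int" where
  "sup_norm v = Max ((\<lambda>i. \<bar>v $ i\<bar>) ` {..<dim_vec v})"

definition root_vec :: "nat \<Rightarrow> int vec" where
  "root_vec x = vec_of_list [0, int x, int x, int x]"

definition cycle_mat :: "int mat" where
  "cycle_mat = S4 * S3 * S2 * S1"

definition R :: "nat \<Rightarrow> int mat" where
  "R n = [1\<^sub>m 4, S1, S2 * S1, S3 * S2 * S1] ! (n mod 4) * cycle_mat ^\<^sub>m (n div 4)"

text \<open>
  Here \<open>\<gamma> = (u + sqrt (u\<^sup>2 - 4)) / 2\<close> with \<open>u = (7 + 3 * sqrt 13) / 2\<close> the larger root of
  \<open>u\<^sup>2 - 7 * u - 17\<close>, obtained from the palindromic quartic by setting \<open>u = t + 1 / t\<close>.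
  The coefficient 3 of the first \<open>sqrt 13\<close> is essential: with coefficient 1 the value would be
  about 6.99, which is not a root of the quartic.
\<close>

definition growth_const :: real where
  "growth_const = (7 + 3 * sqrt 13 + 2 * sqrt (75 / 2 + 21 * sqrt 13 / 2)) / 4"

end

theory Submission
  imports Defs "HOL-Library.Multiset"
begin

text \<open>
  A generator replaces one coordinate by the sum of the other three minus itself. It preserves the
  quadratic form \<open>3 * (a\<^sup>2 + b\<^sup>2 + c\<^sup>2 + d\<^sup>2) - (a + b + c + d)\<^sup>2\<close>, for which the start vector is isotropic,
  and this forces all coordinates along the orbit to stay nonnegative. On sorted nonnegative vectors
  the greedy move, which replaces the smallest coordinate, is optimal with respect to the order given
  by a suitable cone, and it is monotone for this order; so no word of length \<open>n\<close>, reduced or not,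
  beats \<open>n\<close> greedy moves, which is what \<open>R n\<close> performs. The same cone order compares the greedy orbit
  with the eigenvector \<open>(1, l, l\<^sup>2, l\<^sup>3)\<close> of the greedy move, where \<open>l ^ 4 = growth_const\<close>.
\<close>

section \<open>The four reflections acting on explicit vectors\<close>

lemma S_mult_vec:
  "S1 *\<^sub>v vec_of_list [a, b, c, d] = vec_of_list [b + c + d - a, b, c, d]"
  "S2 *\<^sub>v vec_of_list [a, b, c, d] = vec_of_list [a, a + c + d - b, c, d]"
  "S3 *\<^sub>v vec_of_list [a, b, c, d] = vec_of_list [a, b, a + b + d - c, d]"
  "S4 *\<^sub>v vec_of_list [a, b, c, d] = vec_of_list [a, b, c, a + b + c - d]"
  by (rule eq_vecI;
      auto simp: S1_def S2_def S3_def S4_def mat_of_rows_list_def scalar_prod_def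
        numeral_eq_Suc less_Suc_eq)+

lemma S_carrier [simp]:
  "S1 \<in> carrier_mat 4 4" "S2 \<in> carrier_mat 4 4" "S3 \<in> carrier_mat 4 4" "S4 \<in> carrier_mat 4 4"
  by (auto simp: S1_def S2_def S3_def S4_def mat_of_rows_list_def)

lemma cycle_mat_carrier [simp]: "cycle_mat \<in> carrier_mat 4 4"
  unfolding cycle_mat_def by (intro mult_carrier_mat[of _ 4 4 _ 4] S_carrier)

lemma word_prod_carrier:
  "w \<in> lists generators \<Longrightarrow> word_prod w \<in> carrier_mat 4 4"
proof (induction w)
  case (Cons s w)
  then have "s \<in> carrier_mat 4 4" "word_prod w \<in> carrier_mat 4 4"
    by (auto simp: generators_def)
  then show ?case
    using mult_carrier_mat[of s 4 4 "word_prod w" 4] by (simp add: word_prod_def)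
qed (simp add: word_prod_def)

lemma vec4_carrier [simp]: "vec_of_list [a, b, c, d] \<in> carrier_vec 4"
  by (rule carrier_vecI) simp

lemma sup_norm_vec4:
  "sup_norm (vec_of_list [a, b, c, d]) = Max {\<bar>a\<bar>, \<bar>b\<bar>, \<bar>c\<bar>, \<bar>d\<bar>}"
proof -
  have "(\<lambda>i. \<bar>vec_of_list [a, b, c, d] $ i\<bar>) ` {..<4} = {\<bar>a\<bar>, \<bar>b\<bar>, \<bar>c\<bar>, \<bar>d\<bar>}"
    by (simp add: numeral_eq_Suc lessThan_Suc insert_commute)
  moreover have "dim_vec (vec_of_list [a, b, c, d]) = 4"
    by simp
  ultimately show ?thesis
    by (simp only: sup_norm_def)
qed

text \<open>Keeps \<open>vec_of_list [a, b, c, d]\<close> intact as the pattern on which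
  \<open>S_mult_vec\<close> and \<open>sup_norm_vec4\<close> rewrite.\<close>

declare vec_of_list_Cons [simp del]

section \<open>The extremal orbit\<close>

text \<open>The greedy orbit of (0,1,1,1) as one sequence: a window of four consecutive terms is a
  vector, and a move replaces its oldest term by the next one.\<close>

fun extremal_seq :: "nat \<Rightarrow> int" where
  "extremal_seq 0 = 0"
| "extremal_seq (Suc 0) = 1"
| "extremal_seq (Suc (Suc 0)) = 1"
| "extremal_seq (Suc (Suc (Suc 0))) = 1"
| "extremal_seq (Suc (Suc (Suc (Suc n)))) =
     extremal_seq (n + 1) + extremal_seq (n + 2) + extremal_seq (n + 3) - extremal_seq n"

lemma extremal_seq_rec:
  "extremal_seq (n + 4) =
     extremal_seq (n + 1) + extremal_seq (n + 2) + extremal_seq (n + 3) - extremal_seq n"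
  using extremal_seq.simps(5)[of n] by (simp add: numeral_eq_Suc)

text \<open>Writing a for the sequence, a(n+4) - a(n+3) = (a(n+1) - a(n)) + a(n+2), so the induction
  has to carry the whole window.\<close>

lemma extremal_seq_mono_aux:
  "0 \<le> extremal_seq n \<and> extremal_seq n \<le> extremal_seq (n + 1) \<and>
   extremal_seq (n + 1) \<le> extremal_seq (n + 2) \<and> extremal_seq (n + 2) \<le> extremal_seq (n + 3)"
proof (induction n)
  case (Suc n)
  then show ?case
    using extremal_seq_rec[of n] by (simp add: numeral_eq_Suc)
qed (simp add: numeral_eq_Suc)

lemma extremal_seq_nonneg: "0 \<le> extremal_seq n"
  using extremal_seq_mono_aux by blast

lemma extremal_seq_mono: "m \<le> n \<Longrightarrow> extremal_seq m \<le> extremal_seq n"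
  by (rule lift_Suc_mono_le) (use extremal_seq_mono_aux in auto)

definition extremal :: "nat \<Rightarrow> nat \<Rightarrow> int" where
  "extremal x n = int x * extremal_seq n"

lemma extremal_rec:
  "extremal x (n + 4) = extremal x (n + 1) + extremal x (n + 2) + extremal x (n + 3) - extremal x n"
  by (simp add: extremal_def extremal_seq_rec algebra_simps)

lemma extremal_rec':
  "extremal x (n + 5) = extremal x (n + 2) + extremal x (n + 3) + extremal x (n + 4) - extremal x (n + 1)"
  "extremal x (n + 6) = extremal x (n + 3) + extremal x (n + 4) + extremal x (n + 5) - extremal x (n + 2)"
  "extremal x (n + 7) = extremal x (n + 4) + extremal x (n + 5) + extremal x (n + 6) - extremal x (n + 3)"
  using extremal_rec[of x "n + 1"] extremal_rec[of x "n + 2"] extremal_rec[of x "n + 3"]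
  by (simp_all add: add.assoc del: One_nat_def add_2_eq_Suc add_2_eq_Suc')

lemma extremal_nonneg: "0 \<le> extremal x n"
  by (simp add: extremal_def extremal_seq_nonneg)

lemma extremal_mono: "m \<le> n \<Longrightarrow> extremal x m \<le> extremal x n"
  by (simp add: extremal_def extremal_seq_mono mult_left_mono)

lemma root_vec_extremal:
  "root_vec x = vec_of_list [extremal x 0, extremal x 1, extremal x 2, extremal x 3]"
  by (simp add: root_vec_def extremal_def numeral_eq_Suc)

lemma cycle_mat_mult_vec:
  "cycle_mat *\<^sub>v v = S4 *\<^sub>v (S3 *\<^sub>v (S2 *\<^sub>v (S1 *\<^sub>v v)))" if "v \<in> carrier_vec 4"
proof -
  have S: "S4 * S3 \<in> carrier_mat 4 4" "S4 * S3 * S2 \<in> carrier_mat 4 4"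
    by (intro mult_carrier_mat[of _ 4 4 _ 4] S_carrier)+
  have v: "S1 *\<^sub>v v \<in> carrier_vec 4"
    by (rule mult_mat_vec_carrier[OF S_carrier(1) that])
  then have v': "S2 *\<^sub>v (S1 *\<^sub>v v) \<in> carrier_vec 4"
    by (rule mult_mat_vec_carrier[OF S_carrier(2)])
  show ?thesis
    unfolding cycle_mat_def
    using that S v v' by (simp add: assoc_mult_mat_vec[of _ 4 4 _ 4])
qed

text \<open>\<open>S1\<close> acts first and replaces the oldest term; \<open>S2\<close>,
  \<open>S3\<close>, \<open>S4\<close> then each meet the oldest remaining one.\<close>

lemma cycle_mat_extremal:
  "cycle_mat *\<^sub>v vec_of_list [extremal x n, extremal x (n + 1), extremal x (n + 2), extremal x (n + 3)] =
   vec_of_list [extremal x (n + 4), extremal x (n + 4 + 1), extremal x (n + 4 + 2), extremal x (n + 4 + 3)]"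
  by (simp add: cycle_mat_mult_vec S_mult_vec extremal_rec extremal_rec' algebra_simps del: One_nat_def add_2_eq_Suc add_2_eq_Suc')

lemma cycle_mat_pow_extremal:
  "cycle_mat ^\<^sub>m m *\<^sub>v
     vec_of_list [extremal x n, extremal x (n + 1), extremal x (n + 2), extremal x (n + 3)] =
   vec_of_list [extremal x (n + 4 * m), extremal x (n + 4 * m + 1),
     extremal x (n + 4 * m + 2), extremal x (n + 4 * m + 3)]"
proof (induction m arbitrary: n)
  case 0
  have "dim_row cycle_mat = 4"
    using cycle_mat_carrier by blast
  then show ?case by (simp add: one_mult_mat_vec[OF vec4_carrier])
next
  case (Suc m)
  have "cycle_mat ^\<^sub>m m \<in> carrier_mat 4 4"
    by (simp add: pow_carrier_mat)
  \<comment> \<open>Powers split off their last factor on the right, so the first cycle shifts the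
    window and the induction hypothesis is needed at \<open>n + 4\<close>.\<close>
  then have "cycle_mat ^\<^sub>m Suc m *\<^sub>v v = cycle_mat ^\<^sub>m m *\<^sub>v (cycle_mat *\<^sub>v v)"
    if "v \<in> carrier_vec 4" for v
    using that by (simp add: assoc_mult_mat_vec[of _ 4 4 _ 4])
  moreover have "n + 4 * Suc m = n + 4 + 4 * m"
    by simp
  ultimately show ?case
    using Suc[of "n + 4"] by (simp only: cycle_mat_extremal vec4_carrier)
qed

text \<open>After n moves the coordinates are the terms n to n+3 stored cyclically: position j,
  counted from 0, holds the index congruent to j modulo 4.\<close>

lemma R_root_vec:
  fixes m x :: nat
  defines "e \<equiv> \<lambda>i. extremal x (4 * m + i)"
  shows "R (4 * m) *\<^sub>v root_vec x = vec_of_list [e 0, e 1, e 2, e 3]"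
    and "R (4 * m + 1) *\<^sub>v root_vec x = vec_of_list [e 4, e 1, e 2, e 3]"
    and "R (4 * m + 2) *\<^sub>v root_vec x = vec_of_list [e 4, e 5, e 2, e 3]"
    and "R (4 * m + 3) *\<^sub>v root_vec x = vec_of_list [e 4, e 5, e 6, e 3]"
proof -
  have e: "e 4 = e 1 + e 2 + e 3 - e 0" "e 5 = e 2 + e 3 + e 4 - e 1" "e 6 = e 3 + e 4 + e 5 - e 2"
    by (simp_all add: e_def extremal_rec extremal_rec' del: One_nat_def add_2_eq_Suc add_2_eq_Suc')
  have C: "cycle_mat ^\<^sub>m m \<in> carrier_mat 4 4"
    by (simp add: pow_carrier_mat)
  have S: "S1 \<in> carrier_mat 4 4" "S2 \<in> carrier_mat 4 4" "S3 \<in> carrier_mat 4 4"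
    "S2 * S1 \<in> carrier_mat 4 4" "S3 * S2 \<in> carrier_mat 4 4" "S3 * S2 * S1 \<in> carrier_mat 4 4"
    by (intro mult_carrier_mat[of _ 4 4 _ 4] S_carrier)+
  have r: "root_vec x \<in> carrier_vec 4"
    by (simp add: root_vec_def)
  have *: "cycle_mat ^\<^sub>m m *\<^sub>v root_vec x = vec_of_list [e 0, e 1, e 2, e 3]"
    using cycle_mat_pow_extremal[of m x 0]
    by (simp only: root_vec_extremal e_def add_0 add_0_right)
  have d: "(4 * m + 2) div 4 = m" "(4 * m + 3) div 4 = m" "(4 * m + 2) mod 4 = 2" "(4 * m + 3) mod 4 = 3"
    "(4 * m + 1) div 4 = m" "(4 * m + 1) mod 4 = 1"
    by presburger+
  show "R (4 * m) *\<^sub>v root_vec x = vec_of_list [e 0, e 1, e 2, e 3]"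
    using * C r by (simp add: R_def left_mult_one_mat[OF C])
  have 1: "S1 *\<^sub>v (cycle_mat ^\<^sub>m m *\<^sub>v root_vec x) = vec_of_list [e 4, e 1, e 2, e 3]"
    unfolding * S_mult_vec e by simp
  then have 2: "S2 *\<^sub>v (S1 *\<^sub>v (cycle_mat ^\<^sub>m m *\<^sub>v root_vec x)) = vec_of_list [e 4, e 5, e 2, e 3]"
    by (simp add: S_mult_vec e(2) add_ac)
  then have 3: "S3 *\<^sub>v (S2 *\<^sub>v (S1 *\<^sub>v (cycle_mat ^\<^sub>m m *\<^sub>v root_vec x))) =
      vec_of_list [e 4, e 5, e 6, e 3]"
    by (simp add: S_mult_vec e(3) add_ac)
  have v: "cycle_mat ^\<^sub>m m *\<^sub>v root_vec x \<in> carrier_vec 4"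
    "S1 *\<^sub>v (cycle_mat ^\<^sub>m m *\<^sub>v root_vec x) \<in> carrier_vec 4"
    unfolding 1 unfolding * by (rule vec4_carrier)+
  show "R (4 * m + 1) *\<^sub>v root_vec x = vec_of_list [e 4, e 1, e 2, e 3]"
    using 1 by (simp add: R_def d assoc_mult_mat_vec[OF S(1) C r] del: One_nat_def)
  show "R (4 * m + 2) *\<^sub>v root_vec x = vec_of_list [e 4, e 5, e 2, e 3]"
    using 2 by (simp add: R_def d assoc_mult_mat_vec[OF S(4) C r]
      assoc_mult_mat_vec[OF S(2,1) v(1)] del: add_2_eq_Suc add_2_eq_Suc')
  show "R (4 * m + 3) *\<^sub>v root_vec x = vec_of_list [e 4, e 5, e 6, e 3]"
    using 3 by (simp add: R_def d assoc_mult_mat_vec[OF S(6) C r]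
      assoc_mult_mat_vec[OF S(5,1) v(1)] assoc_mult_mat_vec[OF S(3,2) v(2)])
qed

text \<open>By monotonicity the newest term of the window is the largest.\<close>

lemma sup_norm_R: "sup_norm (R n *\<^sub>v root_vec x) = extremal x (n + 3)"
proof -
  define m where "m = n div 4"
  have "n = 4 * m \<or> n = 4 * m + 1 \<or> n = 4 * m + 2 \<or> n = 4 * m + 3"
    unfolding m_def by presburger
  then consider "n = 4 * m" | "n = 4 * m + 1" | "n = 4 * m + 2" | "n = 4 * m + 3"
    by blast
  then show ?thesis
  proof cases
    case 1
    show ?thesis
      unfolding 1 R_root_vec sup_norm_vec4 abs_of_nonneg[OF extremal_nonneg] add.assoc
      by (rule Max_eqI) (auto intro: extremal_mono)
  next
    case 2
    show ?thesis
      unfolding 2 R_root_vec sup_norm_vec4 abs_of_nonneg[OF extremal_nonneg] add.assoc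
      by (rule Max_eqI) (auto intro: extremal_mono)
  next
    case 3
    show ?thesis
      unfolding 3 R_root_vec sup_norm_vec4 abs_of_nonneg[OF extremal_nonneg] add.assoc
      by (rule Max_eqI) (auto intro: extremal_mono)
  next
    case 4
    show ?thesis
      unfolding 4 R_root_vec sup_norm_vec4 abs_of_nonneg[OF extremal_nonneg] add.assoc
      by (rule Max_eqI) (auto intro: extremal_mono)
  qed
qed

section \<open>The greedy bound for arbitrary words\<close>

text \<open>
  The comparison is with respect to the cone of all \<open>(d\<^sub>1, d\<^sub>2, d\<^sub>3, d\<^sub>4)\<close> with
  \<open>d\<^sub>1, d\<^sub>2, d\<^sub>3 \<ge> 0\<close> and \<open>d\<^sub>4 \<ge> d\<^sub>1\<close>, which the map
  \<open>(p, q, s, t) \<mapsto> (q, s, t, q + s + t - p)\<close> preserves.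
\<close>

definition dominated :: "nat \<Rightarrow> nat \<Rightarrow> int multiset \<Rightarrow> bool" where
  "dominated x n M \<longleftrightarrow> (\<exists>p q s t. M = {#p, q, s, t#} \<and> 0 \<le> p \<and> p \<le> q \<and> q \<le> s \<and> s \<le> t \<and>
     p \<le> extremal x n \<and> q \<le> extremal x (n + 1) \<and> s \<le> extremal x (n + 2) \<and>
     t - p \<le> extremal x (n + 3) - extremal x n)"

text \<open>The largest entry is bounded by adding the bound on \<open>t - p\<close> to the bound on
  \<open>p\<close>.\<close>

lemma dominated_le:
  assumes "dominated x n M" "y \<in># M"
  shows "0 \<le> y \<and> y \<le> extremal x (n + 3)"
proof -
  obtain p q s t where "M = {#p, q, s, t#}" "0 \<le> p" "p \<le> q" "q \<le> s" "s \<le> t"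
    "p \<le> extremal x n" "t - p \<le> extremal x (n + 3) - extremal x n"
    using assms(1) unfolding dominated_def by blast
  with assms(2) show ?thesis
    by auto
qed

lemma insert_sorted3:
  fixes e f g u :: int
  assumes "e \<le> f" "f \<le> g"
  obtains p q s t where "{#p, q, s, t#} = {#u, e, f, g#}" "p \<le> q" "q \<le> s" "s \<le> t"
    "p \<le> e" "q \<le> f" "s \<le> g" "t = max u g" "p = min u e"
proof -
  consider "u \<le> e" | "e \<le> u" "u \<le> f" | "f \<le> u" "u \<le> g" | "g \<le> u"
    by linarith
  then show ?thesis
  proof cases
    case 1
    with assms show ?thesis by (intro that[of u e f g]) auto
  next
    case 2
    with assms show ?thesis by (intro that[of e u f g]) auto
  next
    case 3
    with assms show ?thesis by (intro that[of e f u g]) auto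
  next
    case 4
    with assms show ?thesis by (intro that[of e f g u]) auto
  qed
qed

text \<open>Whichever entry is replaced, the three kept ones are at most \<open>q\<close>,
  \<open>s\<close>, \<open>t\<close>, and inserting a value only lowers the first three sorted
  positions. The new spread is at most \<open>s + (t - p)\<close>, with equality for the greedy
  choice \<open>y = p\<close>; the recurrence turns its bound into that of the next window.\<close>

lemma dominated_reflect:
  assumes "dominated x n (add_mset y N)" "0 \<le> \<Sum>\<^sub># N - y"
  shows "dominated x (Suc n) (add_mset (\<Sum>\<^sub># N - y) N)"
proof -
  obtain p q s t where M: "add_mset y N = {#p, q, s, t#}"
    and o: "0 \<le> p" "p \<le> q" "q \<le> s" "s \<le> t"
    and b: "p \<le> extremal x n" "q \<le> extremal x (n + 1)" "s \<le> extremal x (n + 2)"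
      "t - p \<le> extremal x (n + 3) - extremal x n"
    using assms(1) unfolding dominated_def by blast
  have "y \<in># {#p, q, s, t#}"
    using M by (metis union_single_eq_member)
  then consider "y = p" | "y = q" | "y = s" | "y = t"
    by auto
  then obtain e f g where N: "N = {#e, f, g#}" and "e \<le> f" "f \<le> g" and le: "e \<le> q" "f \<le> s" "g \<le> t"
    and spread: "max (\<Sum>\<^sub># N - y) g - min (\<Sum>\<^sub># N - y) e \<le> s + t - p"
  proof cases
    case 1
    then have "N = {#q, s, t#}" using M by simp
    with 1 o assms(2) that[of q s t] show ?thesis by (auto simp: max_def min_def)
  next
    case 2
    then have "N = {#p, s, t#}" using M by simp
    with 2 o assms(2) that[of p s t] show ?thesis by (auto simp: max_def min_def)
  next
    case 3
    then have "N = {#p, q, t#}" using M by simp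
    with 3 o assms(2) that[of p q t] show ?thesis by (auto simp: max_def min_def)
  next
    case 4
    then have "N = {#p, q, s#}" using M by simp
    with 4 o assms(2) that[of p q s] show ?thesis by (auto simp: max_def min_def)
  qed
  obtain p' q' s' t' where new: "{#p', q', s', t'#} = {#\<Sum>\<^sub># N - y, e, f, g#}"
    and o': "p' \<le> q'" "q' \<le> s'" "s' \<le> t'"
    and le': "p' \<le> e" "q' \<le> f" "s' \<le> g"
    and max: "t' = max (\<Sum>\<^sub># N - y) g" and min: "p' = min (\<Sum>\<^sub># N - y) e"
    using insert_sorted3[OF \<open>e \<le> f\<close> \<open>f \<le> g\<close>] by metis
  have "e \<in># {#p, q, s, t#}"
    unfolding M[symmetric] N by simp
  with o have "0 \<le> e"
    by auto
  then have "0 \<le> p'"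
    using assms(2) min by simp
  moreover have "p' \<le> extremal x (Suc n)" "q' \<le> extremal x (Suc n + 1)"
    using le le' b by simp_all
  moreover have "t \<le> extremal x (n + 3)"
    using b by linarith
  then have "s' \<le> extremal x (Suc n + 2)"
    using le le' by (simp add: numeral_eq_Suc)
  moreover have "t' - p' \<le> extremal x (n + 2) + extremal x (n + 3) - extremal x n"
    using spread max min b by linarith
  then have "t' - p' \<le> extremal x (Suc n + 3) - extremal x (Suc n)"
    using extremal_rec[of x n] by (simp add: numeral_eq_Suc)
  moreover have "add_mset (\<Sum>\<^sub># N - y) N = {#p', q', s', t'#}"
    using new N by simp
  ultimately show ?thesis
    unfolding dominated_def using o' by blast
qed

text \<open>
  On the hyperplane with coordinate sum 1 the isotropic vectors form the sphere inscribed in the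
  standard simplex.
\<close>

definition isotropic :: "int multiset \<Rightarrow> bool" where
  "isotropic M \<longleftrightarrow> (\<Sum>\<^sub># M)\<^sup>2 = 3 * (\<Sum>y\<in>#M. y\<^sup>2)"

text \<open>Solving the isotropy equation for the product of \<open>a\<close> and its reflection
  gives a sum of squares of differences.\<close>

lemma isotropic_reflect_nonneg:
  fixes a b c d :: int
  assumes "isotropic {#a, b, c, d#}" "0 \<le> a" "0 \<le> b" "0 \<le> c" "0 \<le> d"
  shows "0 \<le> b + c + d - a"
proof (cases "a = 0")
  case False
  have "2 * a * (b + c + d - a) = (b - c)\<^sup>2 + (b - d)\<^sup>2 + (c - d)\<^sup>2"
    using assms(1) by (simp add: isotropic_def power2_eq_square algebra_simps)
  also have "\<dots> \<ge> 0"
    by simp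
  finally show ?thesis
    using assms(2) False by (simp add: zero_le_mult_iff)
qed (use assms in simp)

text \<open>With \<open>b\<close>, \<open>c\<close>, \<open>d\<close> fixed, isotropy is quadratic
  in \<open>a\<close> with root sum \<open>b + c + d\<close>, so the reflection is the other
  root.\<close>

lemma isotropic_reflect:
  fixes a b c d :: int
  assumes "isotropic {#a, b, c, d#}"
  shows "isotropic {#b + c + d - a, b, c, d#}"
  using assms by (simp add: isotropic_def power2_eq_square algebra_simps)

lemma reflect_step:
  fixes a b c d :: int
  assumes "isotropic {#a, b, c, d#}" "dominated x n {#a, b, c, d#}"
  shows "isotropic {#b + c + d - a, b, c, d#} \<and> dominated x (Suc n) {#b + c + d - a, b, c, d#}"
proof -
  have "0 \<le> b + c + d - a"
    using dominated_le[OF assms(2)] by (intro isotropic_reflect_nonneg assms) auto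
  then show ?thesis
    using dominated_reflect[of x n a "{#b, c, d#}"] assms isotropic_reflect
    by (simp add: add.assoc)
qed

text \<open>The head letter acts last, so list induction follows the orbit. Isotropy is carried
  along because it supplies the nonnegativity required by \<open>dominated_reflect\<close>.\<close>

lemma word_dominated:
  assumes "w \<in> lists generators"
  shows "\<exists>a b c d. word_prod w *\<^sub>v root_vec x = vec_of_list [a, b, c, d] \<and>
    isotropic {#a, b, c, d#} \<and> dominated x (length w) {#a, b, c, d#}"
  using assms
proof (induction w)
  case Nil
  have "1\<^sub>m 4 *\<^sub>v root_vec x = root_vec x"
    by (simp add: root_vec_def one_mult_mat_vec[OF vec4_carrier])
  moreover have "dominated x 0 {#0, int x, int x, int x#}"
    unfolding dominated_def
    by (intro exI[of _ 0] exI[of _ "int x"]) (simp add: extremal_def numeral_eq_Suc)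
  ultimately have "word_prod [] *\<^sub>v root_vec x = vec_of_list [0, int x, int x, int x] \<and>
      isotropic {#0, int x, int x, int x#} \<and> dominated x (length []) {#0, int x, int x, int x#}"
    by (simp add: word_prod_def root_vec_def isotropic_def power2_eq_square)
  then show ?case by blast
next
  case (Cons S w)
  then obtain a b c d where v: "word_prod w *\<^sub>v root_vec x = vec_of_list [a, b, c, d]"
    and inv: "isotropic {#a, b, c, d#}" "dominated x (length w) {#a, b, c, d#}"
    by auto
  have S: "S \<in> generators" and w: "w \<in> lists generators"
    using Cons.hyps by auto
  then have "S \<in> carrier_mat 4 4"
    by (auto simp: generators_def)
  then have Sv: "word_prod (S # w) *\<^sub>v root_vec x = S *\<^sub>v vec_of_list [a, b, c, d]"
    using assoc_mult_mat_vec[of S 4 4 "word_prod w" 4 "root_vec x"] word_prod_carrier[OF w] v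
    by (simp add: word_prod_def root_vec_def)
  consider "S = S1" | "S = S2" | "S = S3" | "S = S4"
    using S by (auto simp: generators_def)
  then obtain a' b' c' d' where "S *\<^sub>v vec_of_list [a, b, c, d] = vec_of_list [a', b', c', d']"
    "isotropic {#a', b', c', d'#}" "dominated x (Suc (length w)) {#a', b', c', d'#}"
  proof cases
    case 1
    with reflect_step[OF inv] show ?thesis
      using S_mult_vec(1) that by blast
  next
    case 2
    \<comment> \<open>\<open>reflect_step\<close> reflects the first entry; reordering the multiset
      moves any other entry to the front.\<close>
    have "{#a, b, c, d#} = {#b, a, c, d#}" "{#a + c + d - b, a, c, d#} = {#a, a + c + d - b, c, d#}"
      by (simp_all add: add_mset_commute)
    with 2 reflect_step[of b a c d x "length w"] inv show ?thesis
      using S_mult_vec(2)[of a b c d] that by simp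
  next
    case 3
    have "{#a, b, c, d#} = {#c, a, b, d#}" "{#a + b + d - c, a, b, d#} = {#a, b, a + b + d - c, d#}"
      by (simp_all add: add_mset_commute)
    with 3 reflect_step[of c a b d x "length w"] inv show ?thesis
      using S_mult_vec(3)[of a b c d] that by simp
  next
    case 4
    have "{#a, b, c, d#} = {#d, a, b, c#}" "{#a + b + c - d, a, b, c#} = {#a, b, c, a + b + c - d#}"
      by (simp_all add: add_mset_commute)
    with 4 reflect_step[of d a b c x "length w"] inv show ?thesis
      using S_mult_vec(4)[of a b c d] that by simp
  qed
  with Sv show ?case
    by auto
qed

lemma sup_norm_word_le:
  assumes "w \<in> lists generators"
  shows "sup_norm (word_prod w *\<^sub>v root_vec x) \<le> sup_norm (R (length w) *\<^sub>v root_vec x)"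
proof -
  obtain a b c d where v: "word_prod w *\<^sub>v root_vec x = vec_of_list [a, b, c, d]"
    and dom: "dominated x (length w) {#a, b, c, d#}"
    using word_dominated[OF assms] by blast
  show ?thesis
    unfolding v sup_norm_R sup_norm_vec4
    using dominated_le[OF dom] by simp
qed

section \<open>The growth constant\<close>

lemma sqrt13_bounds: "3.6055 < sqrt 13" "sqrt 13 < 3.6056"
  by (rule real_less_rsqrt real_less_lsqrt; simp add: power2_eq_square)+

lemma growth_const_approx: "\<bar>growth_const - 8.795\<bar> < 0.0005"
proof -
  \<comment> \<open>The lower side is tight: these brackets give 8.794525 against the required
    8.7945.\<close>
  have "8.6808 < sqrt (75 / 2 + 21 * sqrt 13 / 2)"
    using sqrt13_bounds by (intro real_less_rsqrt) (simp add: power2_eq_square)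
  moreover have "sqrt (75 / 2 + 21 * sqrt 13 / 2) < 8.681"
    using sqrt13_bounds by (intro real_less_lsqrt) (simp_all add: power2_eq_square)
  ultimately show ?thesis
    using sqrt13_bounds by (simp add: growth_const_def abs_less_iff)
qed

lemma growth_const_gt: "8 < growth_const"
  using growth_const_approx unfolding abs_less_iff by (simp add: field_simps)

text \<open>With u = (7 + 3 sqrt 13)/2 the inner radicand is u^2 - 4, the discriminant of t^2 - u t
  + 1.\<close>

lemma growth_const_quadratic: "growth_const\<^sup>2 - (7 + 3 * sqrt 13) / 2 * growth_const + 1 = 0"
proof -
  define q where "q = sqrt (75 / 2 + 21 * sqrt 13 / 2)"
  have "q\<^sup>2 = 75 / 2 + 21 * sqrt 13 / 2"
    unfolding q_def by (rule real_sqrt_pow2) simp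
  then have q: "2 * q\<^sup>2 = 75 + 21 * sqrt 13"
    by simp
  have s: "(sqrt 13)\<^sup>2 = (13::real)"
    by simp
  have "4 * growth_const = 7 + 3 * sqrt 13 + 2 * q"
    by (simp add: growth_const_def q_def)
  with q s have "2 * growth_const\<^sup>2 - (7 + 3 * sqrt 13) * growth_const + 2 = 0"
    by Groebner_Basis.algebra
  then show ?thesis
    by (simp add: field_simps)
qed

text \<open>Each factor is z + 1/z = u for one root u of u^2 - 7u - 17. The general field serves
  both the real and the complex case.\<close>

lemma quartic_factor:
  fixes z s :: "'a :: field_char_0"
  assumes "s\<^sup>2 = 13"
  shows "poly [:1, -7, -15, -7, 1:] z =
    (z\<^sup>2 - (7 + 3 * s) / 2 * z + 1) * (z\<^sup>2 - (7 - 3 * s) / 2 * z + 1)"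
proof -
  have "4 * ((z\<^sup>2 - (7 + 3 * s) / 2 * z + 1) * (z\<^sup>2 - (7 - 3 * s) / 2 * z + 1)) =
    (2 * z\<^sup>2 - (7 + 3 * s) * z + 2) * (2 * z\<^sup>2 - (7 - 3 * s) * z + 2)"
    by (simp add: field_simps)
  also have "\<dots> = (2 * z\<^sup>2 - 7 * z + 2)\<^sup>2 - 9 * s\<^sup>2 * z\<^sup>2"
    by (simp add: power2_eq_square algebra_simps)
  also have "\<dots> = 4 * (1 - 7 * z - 15 * z\<^sup>2 - 7 * z ^ 3 + z ^ 4)"
    unfolding assms by (simp add: power2_eq_square algebra_simps numeral_eq_Suc)
  finally have "(z\<^sup>2 - (7 + 3 * s) / 2 * z + 1) * (z\<^sup>2 - (7 - 3 * s) / 2 * z + 1) =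
      1 - 7 * z - 15 * z\<^sup>2 - 7 * z ^ 3 + z ^ 4"
    by (subst (asm) mult_left_cancel) simp_all
  then show ?thesis
    by (simp add: algebra_simps numeral_eq_Suc)
qed

lemma growth_const_root: "poly [:1, -7, -15, -7, 1:] growth_const = 0"
  by (subst quartic_factor[of "sqrt 13"], simp, simp only: growth_const_quadratic mult_zero_left)

text \<open>The first factor has the roots \<open>growth_const\<close> and its reciprocal. For the
  second a crude triangle inequality suffices, as its linear coefficient is below 2 in absolute
  value.\<close>

lemma quartic_root_bound:
  fixes z :: complex
  assumes "poly [:1, -7, -15, -7, 1:] z = 0"
  shows "cmod z \<le> growth_const"
proof -
  let ?s = "complex_of_real (sqrt 13)" and ?g = "complex_of_real growth_const"
  have "?s\<^sup>2 = 13"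
    by (simp flip: of_real_power)
  with assms consider "z\<^sup>2 - (7 + 3 * ?s) / 2 * z + 1 = 0" | "z\<^sup>2 - (7 - 3 * ?s) / 2 * z + 1 = 0"
    unfolding quartic_factor[OF \<open>?s\<^sup>2 = 13\<close>] mult_eq_0_iff by blast
  then show ?thesis
  proof cases
    case 1
    have "complex_of_real (growth_const\<^sup>2 - (7 + 3 * sqrt 13) / 2 * growth_const + 1) = 0"
      by (simp only: growth_const_quadratic of_real_0)
    then have "?g\<^sup>2 - (7 + 3 * ?s) / 2 * ?g + 1 = 0"
      by simp
    with 1 have "(z - ?g) * (?g * z - 1) = 0"
      by Groebner_Basis.algebra
    then consider "z = ?g" | "?g * z = 1"
      by auto
    then show ?thesis
    proof cases
      case 2
      then have "cmod ?g * cmod z = 1"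
        by (metis norm_mult norm_one)
      then have "growth_const * cmod z = 1"
        using growth_const_gt by simp
      then have "cmod z = 1 / growth_const"
        using growth_const_gt by (simp add: field_simps)
      then have "cmod z \<le> 1"
        using growth_const_gt by simp
      with growth_const_gt show ?thesis by simp
    qed (use growth_const_gt in simp)
  next
    case 2
    have "z\<^sup>2 = of_real ((7 - 3 * sqrt 13) / 2) * z - 1"
      using 2 by (simp add: algebra_simps)
    then have "cmod (z\<^sup>2) \<le> cmod (of_real ((7 - 3 * sqrt 13) / 2) * z) + 1"
      using norm_triangle_ineq4[of "of_real ((7 - 3 * sqrt 13) / 2) * z" 1] by simp
    also have "\<dots> = \<bar>(7 - 3 * sqrt 13) / 2\<bar> * cmod z + 1"
      by (simp only: norm_mult norm_of_real)
    also have "\<dots> \<le> 2 * cmod z + 1"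
      using sqrt13_bounds by (intro add_right_mono mult_right_mono) auto
    finally have *: "cmod z * (cmod z - 2) \<le> 1"
      by (simp add: norm_mult power2_eq_square algebra_simps)
    have "cmod z \<le> 3"
    proof (rule ccontr)
      assume "\<not> cmod z \<le> 3"
      then have "3 * 1 \<le> cmod z * (cmod z - 2)"
        by (intro mult_mono) auto
      with * show False by simp
    qed
    with growth_const_gt show ?thesis by simp
  qed
qed

text \<open>The recurrence polynomial is palindromic too: u = l + 1/l turns it into u^2 = u + 3, and
  then l^4 + 1/l^4 = 3u + 2. So l^4 and \<open>growth_const\<close> satisfy the same quadratic,
  whose roots are reciprocal; their product exceeds 1, hence they agree.\<close>

lemma growth_const_fourth_root:
  obtains l :: real where "l > 3 / 2" "l ^ 4 = growth_const" "l ^ 4 = l ^ 3 + l ^ 2 + l - 1"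
proof -
  define u where "u = (1 + sqrt 13) / 2"
  define r where "r = sqrt (u\<^sup>2 - 4)"
  define l where "l = (u + r) / 2"
  have u2: "u\<^sup>2 = u + 3"
    by (simp add: u_def power2_eq_square field_simps)
  have u: "2.3 < u" "3 * u + 2 = (7 + 3 * sqrt 13) / 2"
    using sqrt13_bounds by (auto simp: u_def)
  have r2: "r\<^sup>2 = u - 1"
    unfolding r_def using u u2 by simp
  have "1 < r"
    unfolding r_def using u u2 by (simp add: real_less_rsqrt)
  have l: "3 / 2 < l"
    using u \<open>1 < r\<close> by (simp add: l_def)
  have l2: "l\<^sup>2 - u * l + 1 = 0"
    using u2 r2 unfolding l_def by (simp add: power2_eq_square field_simps)
  have rec: "l ^ 4 = l ^ 3 + l ^ 2 + l - 1"
    using l2 u2 by Groebner_Basis.algebra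
  have "(l ^ 4)\<^sup>2 - (3 * u + 2) * l ^ 4 + 1 = 0"
    using l2 u2 by Groebner_Basis.algebra
  with growth_const_quadratic have "(l ^ 4 - growth_const) * (growth_const * l ^ 4 - 1) = 0"
    unfolding u by Groebner_Basis.algebra
  moreover have "1 < growth_const * l ^ 4"
  proof -
    have "1 < growth_const" using growth_const_gt by linarith
    moreover have "1 \<le> l ^ 4" using l by (intro one_le_power) simp
    ultimately show ?thesis by (smt (verit) mult_le_cancel_left1)
  qed
  ultimately have "l ^ 4 = growth_const"
    by simp
  with l rec that show ?thesis by blast
qed

text \<open>The minus sign in the recurrence defeats termwise induction; the differences of the two
  windows instead stay in the cone d1, d2, d3 >= 0, d4 >= d1.\<close>

lemma extremal_seq_le_power:
  fixes l :: real
  assumes "l > 3 / 2" "l ^ 4 = l ^ 3 + l ^ 2 + l - 1"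
  shows "extremal_seq n \<le> l ^ n"
proof -
  have "extremal_seq n \<le> l ^ n \<and> extremal_seq (n + 1) \<le> l ^ (n + 1) \<and>
    extremal_seq (n + 2) \<le> l ^ (n + 2) \<and>
    extremal_seq (n + 3) - extremal_seq n \<le> l ^ (n + 3) - l ^ n"
  proof (induction n)
    case 0
    \<comment> \<open>The initial cone condition d4 >= d1 reads l^3 - 1 >= 1.\<close>
    have "(3 / 2) ^ 2 \<le> l ^ 2" "(3 / 2) ^ 3 \<le> l ^ 3"
      using assms(1) by (intro power_mono; simp)+
    then show ?case
      using assms(1) by (simp add: power2_eq_square numeral_eq_Suc)
  next
    case (Suc n)
    have "l ^ (n + 4) = l ^ (n + 3) + l ^ (n + 2) + l ^ (n + 1) - l ^ n"
      using arg_cong[OF assms(2), of "\<lambda>y. l ^ n * y"] by (simp add: power_add power2_eq_square algebra_simps)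
    with Suc show ?case
      using extremal_seq_rec[of n] by (simp add: numeral_eq_Suc)
  qed
  then show ?thesis by simp
qed

lemma sup_norm_R_bigo:
  "(\<lambda>n. real_of_int (sup_norm (R n *\<^sub>v root_vec x))) \<in> O(\<lambda>n. growth_const powr (real n / 4))"
proof -
  obtain l :: real where l: "l > 3 / 2" "l ^ 4 = growth_const" "l ^ 4 = l ^ 3 + l ^ 2 + l - 1"
    using growth_const_fourth_root by metis
  have eq: "growth_const powr (real n / 4) = l ^ n" for n
  proof -
    have g: "growth_const = l powr 4"
      using l by simp
    show ?thesis
      unfolding g using l(1) by (simp add: powr_powr powr_realpow del: powr_numeral)
  qed
  \<comment> \<open>The factor \<open>l ^ 3\<close> absorbs the index shift \<open>n + 3\<close> in
    \<open>sup_norm_R\<close>.\<close>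
  have "real_of_int (sup_norm (R n *\<^sub>v root_vec x)) \<le> real x * l ^ 3 * l ^ n" for n
    using mult_left_mono[OF extremal_seq_le_power[OF l(1,3), of "n + 3"], of "real x"]
    by (simp add: sup_norm_R extremal_def power_add mult_ac)
  moreover have "0 \<le> sup_norm (R n *\<^sub>v root_vec x)" for n
    by (simp add: sup_norm_R extremal_nonneg)
  ultimately show ?thesis
    unfolding eq using l(1)
    by (intro bigoI[where c = "real x * l ^ 3"] always_eventually) simp
qed

section \<open>The characteristic polynomial\<close>

lemma cycle_mat_eq:
  "cycle_mat = mat_of_rows_list 4
    [[-1, 1, 1, 1], [-1, 0, 2, 2], [-2, 1, 2, 4], [-4, 2, 5, 6]]"
  unfolding cycle_mat_def S1_def S2_def S3_def S4_def
  by (rule eq_matI)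
    (auto simp: mat_of_rows_list_def scalar_prod_def numeral_eq_Suc less_Suc_eq)

lemma det_2:
  assumes "A \<in> carrier_mat 2 2"
  shows "det A = A $$ (0, 0) * A $$ (1, 1) - A $$ (0, 1) * A $$ (1, 0)"
  using assms
  by (simp add: laplace_expansion_row[of A 2 0] cofactor_def det_single mat_delete_def numeral_eq_Suc)

lemma det_3:
  assumes "A \<in> carrier_mat 3 3"
  shows "det A =
      A $$ (0, 0) * (A $$ (1, 1) * A $$ (2, 2) - A $$ (1, 2) * A $$ (2, 1))
    - A $$ (0, 1) * (A $$ (1, 0) * A $$ (2, 2) - A $$ (1, 2) * A $$ (2, 0))
    + A $$ (0, 2) * (A $$ (1, 0) * A $$ (2, 1) - A $$ (1, 1) * A $$ (2, 0))"
  using assms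
  by (simp add: laplace_expansion_row[of A 3 0] cofactor_def det_2 mat_delete_def numeral_eq_Suc
      algebra_simps)

lemma char_poly_cycle_mat: "char_poly cycle_mat = [:1, -7, -15, -7, 1:]"
proof -
  have "char_poly_matrix cycle_mat \<in> carrier_mat 4 4"
    by simp
  then show ?thesis
    unfolding char_poly_def
    by (simp add: laplace_expansion_row[of _ 4 0] cofactor_def det_3 mat_delete_def
        char_poly_matrix_def cycle_mat_eq mat_of_rows_list_def numeral_eq_Suc)
qed

theorem theorem4:
  fixes x :: nat
  shows "(\<forall>n w. reduced_word w \<and> length w = n \<longrightarrow>
            sup_norm (word_prod w *\<^sub>v root_vec x) \<le> sup_norm (R n *\<^sub>v root_vec x)) \<and>
         (\<lambda>n. real_of_int (sup_norm (R n *\<^sub>v root_vec x)))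
            \<in> O(\<lambda>n. growth_const powr (real n / 4)) \<and>
         \<bar>growth_const - 8.795\<bar> < 0.0005 \<and>
         char_poly cycle_mat = [:1, -7, -15, -7, 1:] \<and>
         poly [:1, -7, -15, -7, 1:] growth_const = 0 \<and>
         (\<forall>z :: complex. poly [:1, -7, -15, -7, 1:] z = 0 \<longrightarrow> cmod z \<le> growth_const)"
proof (intro conjI allI impI)
  fix n w
  assume "reduced_word w \<and> length w = n"
  then show "sup_norm (word_prod w *\<^sub>v root_vec x) \<le> sup_norm (R n *\<^sub>v root_vec x)"
    using sup_norm_word_le[of w x] unfolding reduced_word_def by blast
qed (fact sup_norm_R_bigo growth_const_approx char_poly_cycle_mat growth_const_root
  | erule quartic_root_bound)+

end
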